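(* Let $K=\mathbb{C}\{\!\{t\}\!\}$, let $I=\langle f_1,\dots,f_N\rangle\subset K[x_1,\dots,x_N]$ be the equilibrium ideal of a multilinear network game, and let $v\in\operatorname{Trop}(V(I))$ be a valuation vector such that each initial polynomial $\operatorname{in}_v(f_i)$ is a binomial. Then the generator-wise initial system $J_v=\langle\operatorname{in}_v(f_1),\dots,\operatorname{in}_v(f_N)\rangle$, considered on $(\mathbb{C}^* )^N$, can be written in the form $$x^{a_i}=\lambda_i x^{b_i},\qquad i=1,\dots,N,$$ with exponent vectors $a_i,b_i\in\mathbb{Z}_{\ge0}^N$ and $\lambda_i\in\mathbb{C}^*$. Let $A$ be the exponent-difference matrix whose $i$-th row is $a_i-b_i\in\mathbb{Z}^N$, and let $G_v$ be the directed graph on $\{1,\dots,N\}$ with an edge $i\to j$ whenever the variable $x_j$ appears in the binomial $\operatorname{in}_v(f_i)$. Then, after permuting the variables (columns) and equations (rows) by one and the same ordering according to the strongly connected components of $G_v$, the matrix $A$ becomes block upper triangular, with diagonal blocks indexed by the strongly connected components. In particular, the binomial equations are organized into blocks, one per strongly connected component, with dependence between different blocks only as determined by the partial order on the strongly connected components induced by $G_v$ (an equation indexed by a vertex of a component $C$ involves only variables indexed by vertices of $C$ and of components that can be reached from $C$).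
   Context: $K=\mathbb{C}\{\!\{t\}\!\}$ is the field of Puiseux series with its usual valuation $\operatorname{val}$; $\operatorname{lc}(a)\in\mathbb{C}^*$ is the coefficient of $t^{\operatorname{val}(a)}$ in $a\in K^*$. Multilinear network game: the equilibrium polynomials are $f_i=\sum_{S\subseteq[N]\setminus\{i\}}c_{i,S}\prod_{j\in S}x_j$ with $c_{i,S}\in K$, $i=1,\dots,N$; the equilibrium ideal is $I=\langle f_1,\dots,f_N\rangle$. For nonzero $f=\sum_\alpha c_\alpha x^\alpha$ and $v\in\mathbb{R}^N$, $\operatorname{in}_v(f)\in\mathbb{C}[x_1,\dots,x_N]$ is the sum of the terms $\operatorname{lc}(c_\alpha)x^\alpha$ over those $\alpha$ with $c_\alpha\ne0$ at which $\operatorname{val}(c_\alpha)+\alpha\cdot v$ attains its minimum. $\operatorname{in}_v(I)$ is the ideal generated by all $\operatorname{in}_v(f)$, $f\in I$, and $\operatorname{Trop}(V(I))=\{v\in\mathbb{R}^N:\operatorname{in}_v(I)\text{ contains no monomial}\}$. A binomial is a polynomial with exactly two monomials (with nonzero coefficients). *)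

theory Defs
  imports
    "HOL-Analysis.Finite_Cartesian_Product"
    "HOL-Computational_Algebra.Formal_Laurent_Series"
    "HOL-Library.Poly_Mapping"
    "Graph_Theory.Digraph_Component"
    "Graph_Theory.Pair_Digraph"
begin

section \<open>The field of Puiseux series\<close>

unbundle fps_syntax

text \<open>
  A formal Puiseux series is given by its coefficient function on rational exponents. The exponents
  that occur have a common denominator \<open>d\<close> and are bounded below.
\<close>

typedef (overloaded) 'a puiseux =
  "{f :: rat \<Rightarrow> 'a::zero. \<exists>d::nat. d > 0 \<and>
      (\<exists>k0::int. \<forall>q. f q \<noteq> 0 \<longrightarrow> (\<exists>k\<ge>k0. q = of_int k / of_nat d))}"
  morphisms puiseux_coeff Abs_puiseux
  by (rule exI[of _ "\<lambda>_. 0"]) auto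

setup_lifting type_definition_puiseux

lemma puiseux_eqI: "(\<And>q. puiseux_coeff x q = puiseux_coeff y q) \<Longrightarrow> x = y"
  by transfer auto

lemma puiseux_supp_lift:
  assumes "d > 0" "m > 0" "\<exists>k\<ge>k0. q = of_int k / (of_nat d :: rat)"
  shows "\<exists>k \<ge> k0 * int m. q = of_int k / (of_nat (d * m) :: rat)"
proof -
  from assms obtain k where k: "k \<ge> k0" "q = of_int k / of_nat d" by blast
  have "k * int m \<ge> k0 * int m" using k by (simp add: mult_right_mono)
  moreover have "q = of_int (k * int m) / of_nat (d * m)"
    using k assms by simp
  ultimately show ?thesis by blast
qed

lemma puiseux_common_supp:
  fixes f g :: "rat \<Rightarrow> 'a::zero"
  assumes "\<exists>d::nat. d > 0 \<and> (\<exists>k0::int. \<forall>q. f q \<noteq> 0 \<longrightarrow> (\<exists>k\<ge>k0. q = of_int k / of_nat d))"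
    and "\<exists>d::nat. d > 0 \<and> (\<exists>k0::int. \<forall>q. g q \<noteq> 0 \<longrightarrow> (\<exists>k\<ge>k0. q = of_int k / of_nat d))"
  obtains d :: nat and k0 l0 :: int where "d > 0"
    "\<And>q. f q \<noteq> 0 \<Longrightarrow> \<exists>k\<ge>k0. q = of_int k / of_nat d"
    "\<And>q. g q \<noteq> 0 \<Longrightarrow> \<exists>k\<ge>l0. q = of_int k / of_nat d"
proof -
  from assms obtain d1 d2 :: nat and k1 k2 :: int where *: "d1 > 0" "d2 > 0"
    "\<And>q. f q \<noteq> 0 \<Longrightarrow> \<exists>k\<ge>k1. q = of_int k / of_nat d1"
    "\<And>q. g q \<noteq> 0 \<Longrightarrow> \<exists>k\<ge>k2. q = of_int k / of_nat d2" by blast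
  show thesis
  proof (rule that[of "d1 * d2" "k1 * int d2" "k2 * int d1"])
    show "d1 * d2 > 0" using * by simp
    show "\<exists>k\<ge>k1 * int d2. q = of_int k / of_nat (d1 * d2)" if "f q \<noteq> 0" for q
      by (rule puiseux_supp_lift[OF *(1,2) *(3)[OF that]])
    show "\<exists>k\<ge>k2 * int d1. q = of_int k / of_nat (d1 * d2)" if "g q \<noteq> 0" for q
      using puiseux_supp_lift[OF *(2,1) *(4)[OF that]] by (simp add: mult.commute)
  qed
qed

lift_definition puiseux_of_fls :: "nat \<Rightarrow> 'a::zero fls \<Rightarrow> 'a puiseux" is
  "\<lambda>d F q. if d > 0 \<and> of_nat d * q \<in> \<int> then F $$ \<lfloor>of_nat d * q\<rfloor> else 0"
proof -
  fix d :: nat and F :: "'a fls"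
  let ?f = "\<lambda>q::rat. if d > 0 \<and> of_nat d * q \<in> \<int> then F $$ \<lfloor>of_nat d * q\<rfloor> else 0"
  show "\<exists>d::nat. d > 0 \<and> (\<exists>k0::int. \<forall>q. ?f q \<noteq> 0 \<longrightarrow> (\<exists>k\<ge>k0. q = of_int k / of_nat d))"
  proof (cases "d > 0")
    case True
    have "\<exists>k\<ge>fls_subdegree F. q = of_int k / of_nat d" if "?f q \<noteq> 0" for q
    proof -
      have int: "of_nat d * q \<in> \<int>" and nz: "F $$ \<lfloor>of_nat d * q\<rfloor> \<noteq> 0"
        using that by (auto split: if_splits)
      have "\<lfloor>of_nat d * q\<rfloor> \<ge> fls_subdegree F"
        using nz by (rule fls_subdegree_leI)
      moreover have "q = of_int \<lfloor>of_nat d * q\<rfloor> / of_nat d"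
        unfolding of_int_floor[OF int] using True by simp
      ultimately show ?thesis by blast
    qed
    with True show ?thesis by blast
  qed (auto intro: exI[of _ 1])
qed

lemma puiseux_coeff_of_fls [simp]:
  "d > 0 \<Longrightarrow> puiseux_coeff (puiseux_of_fls d F) (of_int k / of_nat d) = F $$ k"
  by transfer simp

lemma puiseux_coeff_of_fls_0:
  "(\<nexists>k. q = of_int k / of_nat d) \<Longrightarrow> puiseux_coeff (puiseux_of_fls d F) q = 0"
proof (transfer fixing: q d, goal_cases)
  case (1 F)
  have False if "d > 0" "of_nat d * q \<in> \<int>"
  proof -
    from that(2) obtain k where "of_nat d * q = of_int k" by (rule Ints_cases)
    hence "q = of_int k / of_nat d"
      using that(1) by (metis nonzero_mult_div_cancel_left of_nat_eq_0_iff less_numeral_extra(3))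
    with 1 show False by blast
  qed
  thus ?case by auto
qed

lemma puiseux_of_fls_eqI:
  assumes "d > 0" "\<And>k. puiseux_coeff x (of_int k / of_nat d) = F $$ k"
    "\<And>q. \<nexists>k. q = of_int k / of_nat d \<Longrightarrow> puiseux_coeff x q = 0"
  shows "x = puiseux_of_fls d F"
proof (rule puiseux_eqI)
  fix q
  show "puiseux_coeff x q = puiseux_coeff (puiseux_of_fls d F) q"
  proof (cases "\<exists>k. q = of_int k / of_nat d")
    case True
    thus ?thesis using assms(1,2) by auto
  next
    case False
    thus ?thesis using assms(3) puiseux_coeff_of_fls_0[of q d F] by simp
  qed
qed

lemma puiseux_of_fls_inject [simp]:
  assumes "d > 0"
  shows "puiseux_of_fls d F = puiseux_of_fls d G \<longleftrightarrow> F = G"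
proof
  assume eq: "puiseux_of_fls d F = puiseux_of_fls d G"
  show "F = G"
  proof (rule fls_eqI)
    show "F $$ k = G $$ k" for k
      using puiseux_coeff_of_fls[OF assms, of F k] puiseux_coeff_of_fls[OF assms, of G k] eq by simp
  qed
qed simp

lemma puiseux_of_fls_ramify:
  assumes "d > 0" "m > 0"
  shows "puiseux_of_fls d F = puiseux_of_fls (d * m) (fls_compose_power F m)"
proof (rule puiseux_of_fls_eqI)
  show "d * m > 0" using assms by simp
  have dm: "(of_nat d :: rat) \<noteq> 0" "(of_nat m :: rat) \<noteq> 0" using assms by simp_all
  have cancel: "of_int (int m * l) / of_nat (d * m) = (of_int l / of_nat d :: rat)" for l
    using nonzero_mult_divide_mult_cancel_left[OF dm(2), of "of_int l" "of_nat d"]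
    by (simp only: of_int_mult of_nat_mult of_int_of_nat_eq mult.commute)
  fix k :: int
  show "puiseux_coeff (puiseux_of_fls d F) (of_int k / of_nat (d * m)) = fls_compose_power F m $$ k"
  proof (cases "int m dvd k")
    case True
    then obtain l where l: "k = int m * l" by (elim dvdE)
    have "puiseux_coeff (puiseux_of_fls d F) (of_int k / of_nat (d * m)) = F $$ l"
      unfolding l cancel using assms(1) by (rule puiseux_coeff_of_fls)
    also have "\<dots> = fls_compose_power F m $$ k"
      unfolding l fls_nth_compose_power[OF assms(2)] using assms(2) by simp
    finally show ?thesis .
  next
    case False
    have "\<nexists>l. (of_int k / of_nat (d * m) :: rat) = of_int l / of_nat d"
    proof
      assume "\<exists>l. (of_int k / of_nat (d * m) :: rat) = of_int l / of_nat d"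
      then obtain l where "(of_int k / of_nat (d * m) :: rat) = of_int l / of_nat d" ..
      hence "(of_int k / of_nat (d * m) :: rat) = of_int (int m * l) / of_nat (d * m)"
        by (simp only: cancel)
      hence "(of_int k :: rat) = of_int (int m * l)"
        using dm by (subst (asm) divide_cancel_right) simp
      hence "k = int m * l" by (simp only: of_int_eq_iff)
      with False show False by simp
    qed
    hence "puiseux_coeff (puiseux_of_fls d F) (of_int k / of_nat (d * m)) = 0"
      by (rule puiseux_coeff_of_fls_0)
    thus ?thesis unfolding fls_nth_compose_power[OF assms(2)] if_not_P[OF False] .
  qed
next
  fix q :: rat assume *: "\<nexists>k. q = of_int k / of_nat (d * m)"
  have "\<nexists>k. q = of_int k / of_nat d"
  proof
    assume "\<exists>k. q = of_int k / of_nat d"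
    then obtain k where k: "q = of_int k / of_nat d" ..
    have "\<exists>k'\<ge>k * int m. q = of_int k' / of_nat (d * m)"
      by (rule puiseux_supp_lift[OF assms]) (use k in blast)
    with * show False by blast
  qed
  thus "puiseux_coeff (puiseux_of_fls d F) q = 0" by (rule puiseux_coeff_of_fls_0)
qed

lemma puiseux_of_fls_exists: "\<exists>d F. d > 0 \<and> x = puiseux_of_fls d F"
proof -
  from puiseux_coeff[of x] obtain d :: nat and k0 :: int where d: "d > 0"
    and k0: "\<And>q. puiseux_coeff x q \<noteq> 0 \<Longrightarrow> \<exists>k\<ge>k0. q = of_int k / of_nat d"
    by blast
  define F where "F = Abs_fls (\<lambda>k. puiseux_coeff x (of_int k / of_nat d))"
  have F: "F $$ k = puiseux_coeff x (of_int k / of_nat d)" for k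
    unfolding F_def
  proof (rule nth_Abs_fls_lower_bound)
    show "\<forall>k<k0. puiseux_coeff x (of_int k / of_nat d) = 0"
    proof (intro allI impI, rule ccontr)
      fix k assume "k < k0" and "puiseux_coeff x (of_int k / of_nat d) \<noteq> 0"
      from k0[OF this(2)] obtain l where "l \<ge> k0" "(of_int k / of_nat d :: rat) = of_int l / of_nat d"
        by blast
      thus False using \<open>k < k0\<close> d by simp
    qed
  qed
  have "x = puiseux_of_fls d F"
  proof (rule puiseux_of_fls_eqI[OF d F[symmetric]])
    show "puiseux_coeff x q = 0" if "\<nexists>k. q = of_int k / of_nat d" for q
      using k0[of q] that by blast
  qed
  with d show ?thesis by blast
qed

lemma puiseux_of_fls_exists3:
  obtains d F G H where "d > 0" "x = puiseux_of_fls d F" "y = puiseux_of_fls d G"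
    "z = puiseux_of_fls d H"
proof -
  obtain a F b G c H where *: "a > 0" "b > 0" "c > 0"
    "x = puiseux_of_fls a F" "y = puiseux_of_fls b G" "z = puiseux_of_fls c H"
    using puiseux_of_fls_exists[of x] puiseux_of_fls_exists[of y] puiseux_of_fls_exists[of z]
    by blast
  show thesis
  proof (rule that[of "a * b * c"])
    show "a * b * c > 0" using * by simp
    show "x = puiseux_of_fls (a * b * c) (fls_compose_power F (b * c))"
      using puiseux_of_fls_ramify[of a "b * c" F] * by (simp add: mult.assoc)
    show "y = puiseux_of_fls (a * b * c) (fls_compose_power G (a * c))"
      using puiseux_of_fls_ramify[of b "a * c" G] * by (simp add: mult_ac)
    show "z = puiseux_of_fls (a * b * c) (fls_compose_power H (a * b))"
      using puiseux_of_fls_ramify[of c "a * b" H] * by (simp add: mult_ac)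
  qed
qed

instantiation puiseux :: (field) field
begin

lift_definition zero_puiseux :: "'a puiseux" is "\<lambda>_. 0"
  by (auto intro: exI[of _ 1])

lift_definition one_puiseux :: "'a puiseux" is "\<lambda>q. if q = 0 then 1 else 0"
  by (rule exI[of _ 1]) (auto intro: exI[of _ 0])

lift_definition plus_puiseux :: "'a puiseux \<Rightarrow> 'a puiseux \<Rightarrow> 'a puiseux" is "\<lambda>f g q. f q + g q"
proof -
  fix f g :: "rat \<Rightarrow> 'a"
  assume "\<exists>d::nat. d > 0 \<and> (\<exists>k0::int. \<forall>q. f q \<noteq> 0 \<longrightarrow> (\<exists>k\<ge>k0. q = of_int k / of_nat d))"
    and "\<exists>d::nat. d > 0 \<and> (\<exists>k0::int. \<forall>q. g q \<noteq> 0 \<longrightarrow> (\<exists>k\<ge>k0. q = of_int k / of_nat d))"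
  then obtain d :: nat and k0 l0 :: int where *: "d > 0"
    "\<And>q. f q \<noteq> 0 \<Longrightarrow> \<exists>k\<ge>k0. q = of_int k / of_nat d"
    "\<And>q. g q \<noteq> 0 \<Longrightarrow> \<exists>k\<ge>l0. q = of_int k / of_nat d"
    by (rule puiseux_common_supp) blast
  have "\<exists>k\<ge>min k0 l0. q = of_int k / of_nat d" if nz: "f q + g q \<noteq> 0" for q
  proof (cases "f q = 0")
    case True
    thus ?thesis using nz *(3)[of q] by (auto simp: min_le_iff_disj)
  next
    case False
    thus ?thesis using *(2)[of q] by (auto simp: min_le_iff_disj)
  qed
  with *(1) show "\<exists>d::nat. d > 0 \<and>
      (\<exists>k0::int. \<forall>q. f q + g q \<noteq> 0 \<longrightarrow> (\<exists>k\<ge>k0. q = of_int k / of_nat d))" by blast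
qed

lift_definition uminus_puiseux :: "'a puiseux \<Rightarrow> 'a puiseux" is "\<lambda>f q. - f q"
  unfolding neg_equal_0_iff_equal .

definition minus_puiseux :: "'a puiseux \<Rightarrow> 'a puiseux \<Rightarrow> 'a puiseux" where
  "minus_puiseux x y = x + - y"

text \<open>The Cauchy product; for Puiseux series, the index set of the sum is finite.\<close>

lift_definition times_puiseux :: "'a puiseux \<Rightarrow> 'a puiseux \<Rightarrow> 'a puiseux" is
  "\<lambda>f g q. \<Sum>r | f r \<noteq> 0 \<and> g (q - r) \<noteq> 0. f r * g (q - r)"
proof -
  fix f g :: "rat \<Rightarrow> 'a"
  assume "\<exists>d::nat. d > 0 \<and> (\<exists>k0::int. \<forall>q. f q \<noteq> 0 \<longrightarrow> (\<exists>k\<ge>k0. q = of_int k / of_nat d))"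
    and "\<exists>d::nat. d > 0 \<and> (\<exists>k0::int. \<forall>q. g q \<noteq> 0 \<longrightarrow> (\<exists>k\<ge>k0. q = of_int k / of_nat d))"
  then obtain d :: nat and k0 l0 :: int where *: "d > 0"
    "\<And>q. f q \<noteq> 0 \<Longrightarrow> \<exists>k\<ge>k0. q = of_int k / of_nat d"
    "\<And>q. g q \<noteq> 0 \<Longrightarrow> \<exists>k\<ge>l0. q = of_int k / of_nat d"
    by (rule puiseux_common_supp) blast
  have "\<exists>k\<ge>k0 + l0. q = of_int k / of_nat d"
    if nz: "(\<Sum>r | f r \<noteq> 0 \<and> g (q - r) \<noteq> 0. f r * g (q - r)) \<noteq> 0" for q
  proof -
    from nz obtain r where "f r \<noteq> 0" "g (q - r) \<noteq> 0"
      by (elim sum.not_neutral_contains_not_neutral) blast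
    then obtain k l where kl: "k \<ge> k0" "r = of_int k / of_nat d" "l \<ge> l0" "q - r = of_int l / of_nat d"
      using *(2)[of r] *(3)[of "q - r"] by blast
    have "q = r + (q - r)" by simp
    also have "\<dots> = of_int k / of_nat d + of_int l / of_nat d"
      unfolding kl(4) unfolding kl(2) ..
    also have "\<dots> = of_int (k + l) / of_nat d"
      unfolding of_int_add add_divide_distrib ..
    finally have "q = of_int (k + l) / of_nat d" .
    moreover have "k0 + l0 \<le> k + l" using kl(1,3) by (rule add_mono)
    ultimately show ?thesis by blast
  qed
  with *(1) show "\<exists>d::nat. d > 0 \<and> (\<exists>k0::int. \<forall>q.
      (\<Sum>r | f r \<noteq> 0 \<and> g (q - r) \<noteq> 0. f r * g (q - r)) \<noteq> 0 \<longrightarrow>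
      (\<exists>k\<ge>k0. q = of_int k / of_nat d))" by blast
qed

definition inverse_puiseux :: "'a puiseux \<Rightarrow> 'a puiseux" where
  "inverse_puiseux x = (if x = 0 then 0 else (THE y. x * y = 1))"

definition divide_puiseux :: "'a puiseux \<Rightarrow> 'a puiseux \<Rightarrow> 'a puiseux" where
  "divide_puiseux x y = x * inverse y"

lemma puiseux_of_fls_0: "d > 0 \<Longrightarrow> puiseux_of_fls d 0 = 0"
  by transfer auto

lemma puiseux_of_fls_1:
  assumes "d > 0"
  shows "puiseux_of_fls d 1 = (1 :: 'a puiseux)"
proof (rule puiseux_of_fls_eqI[symmetric])
  show "puiseux_coeff (1 :: 'a puiseux) (of_int k / of_nat d) = 1 $$ k" for k
    using assms by (simp add: one_puiseux.rep_eq)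
  show "puiseux_coeff (1 :: 'a puiseux) q = 0" if "\<nexists>k. q = of_int k / of_nat d" for q
  proof -
    have "q \<noteq> 0"
    proof
      assume "q = 0"
      hence "q = of_int 0 / of_nat d" by simp
      with that show False by blast
    qed
    thus ?thesis by (simp add: one_puiseux.rep_eq)
  qed
qed (use assms in auto)

lemma puiseux_of_fls_add:
  assumes "d > 0"
  shows "puiseux_of_fls d F + puiseux_of_fls d G = puiseux_of_fls d (F + G :: 'a fls)"
  by (rule puiseux_of_fls_eqI)
     (use assms in \<open>auto simp: plus_puiseux.rep_eq puiseux_coeff_of_fls_0\<close>)

lemma puiseux_of_fls_uminus:
  assumes "d > 0"
  shows "- puiseux_of_fls d F = puiseux_of_fls d (- F :: 'a fls)"
  by (rule puiseux_of_fls_eqI)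
     (use assms in \<open>auto simp: uminus_puiseux.rep_eq puiseux_coeff_of_fls_0\<close>)

lemma puiseux_of_fls_mult:
  fixes F G :: "'a fls"
  assumes d: "d > 0"
  shows "puiseux_of_fls d F * puiseux_of_fls d G = puiseux_of_fls d (F * G)"
proof (rule puiseux_of_fls_eqI)
  let ?x = "puiseux_of_fls d F" and ?y = "puiseux_of_fls d G"
  have ex: "\<exists>k. r = of_int k / of_nat d" if "puiseux_coeff (puiseux_of_fls d H) r \<noteq> 0"
    for r and H :: "'a fls"
    using that puiseux_coeff_of_fls_0[of r d H] by blast
  have diff: "of_int n / of_nat d - of_int k / of_nat d = (of_int (n - k) / of_nat d :: rat)" for n k
    by (simp add: diff_divide_distrib)
  fix n :: int
  let ?q = "of_int n / of_nat d :: rat"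
  have "puiseux_coeff (?x * ?y) ?q =
      (\<Sum>r | puiseux_coeff ?x r \<noteq> 0 \<and> puiseux_coeff ?y (?q - r) \<noteq> 0.
         puiseux_coeff ?x r * puiseux_coeff ?y (?q - r))"
    by (simp add: times_puiseux.rep_eq)
  also have "{r. puiseux_coeff ?x r \<noteq> 0 \<and> puiseux_coeff ?y (?q - r) \<noteq> 0} =
      (\<lambda>k. of_int k / of_nat d) ` {k. F $$ k \<noteq> 0 \<and> G $$ (n - k) \<noteq> 0}" (is "_ = ?h ` ?K")
  proof (intro equalityI subsetI)
    fix r assume r: "r \<in> {r. puiseux_coeff ?x r \<noteq> 0 \<and> puiseux_coeff ?y (?q - r) \<noteq> 0}"
    then obtain k where "r = of_int k / of_nat d" using ex[of F r] by blast
    with r d show "r \<in> ?h ` ?K" by (auto simp: diff simp del: of_int_diff)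
  next
    fix r assume "r \<in> ?h ` ?K"
    thus "r \<in> {r. puiseux_coeff ?x r \<noteq> 0 \<and> puiseux_coeff ?y (?q - r) \<noteq> 0}"
      using d by (auto simp: diff simp del: of_int_diff)
  qed
  also have "(\<Sum>r\<in>?h ` ?K. puiseux_coeff ?x r * puiseux_coeff ?y (?q - r)) =
      (\<Sum>k\<in>?K. F $$ k * G $$ (n - k))"
    using d by (subst sum.reindex) (auto simp: inj_on_def diff simp del: of_int_diff)
  also have "\<dots> = (\<Sum>k = fls_subdegree F..n - fls_subdegree G. F $$ k * G $$ (n - k))"
  proof (rule sum.mono_neutral_left)
    show "?K \<subseteq> {fls_subdegree F..n - fls_subdegree G}"
    proof
      fix k assume "k \<in> ?K"
      hence "fls_subdegree F \<le> k" "fls_subdegree G \<le> n - k"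
        by (auto intro: fls_subdegree_leI)
      thus "k \<in> {fls_subdegree F..n - fls_subdegree G}" by simp
    qed
  qed auto
  also have "\<dots> = (F * G) $$ n" by (simp add: fls_times_nth(2))
  finally show "puiseux_coeff (?x * ?y) ?q = (F * G) $$ n" .
next
  fix q :: rat assume q: "\<nexists>k. q = of_int k / of_nat d"
  have "{r. puiseux_coeff (puiseux_of_fls d F) r \<noteq> 0 \<and>
      puiseux_coeff (puiseux_of_fls d G) (q - r) \<noteq> 0} = {}"
  proof (rule ccontr)
    assume "\<not> ?thesis"
    then obtain r where "puiseux_coeff (puiseux_of_fls d F) r \<noteq> 0"
      "puiseux_coeff (puiseux_of_fls d G) (q - r) \<noteq> 0" by blast
    then obtain k l where r: "r = of_int k / of_nat d" and qr: "q - r = of_int l / of_nat d"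
      using puiseux_coeff_of_fls_0[of r d F] puiseux_coeff_of_fls_0[of "q - r" d G] by blast
    have "q = r + (q - r)" by simp
    also have "\<dots> = of_int k / of_nat d + of_int l / of_nat d"
      unfolding qr unfolding r ..
    also have "\<dots> = of_int (k + l) / of_nat d"
      unfolding of_int_add add_divide_distrib ..
    finally have "q = of_int (k + l) / of_nat d" .
    with q show False by blast
  qed
  thus "puiseux_coeff (puiseux_of_fls d F * puiseux_of_fls d G) q = 0"
    unfolding times_puiseux.rep_eq by (simp only: sum.empty)
qed (use d in auto)

lemmas puiseux_of_fls_hom = puiseux_of_fls_0 [symmetric] puiseux_of_fls_1 [symmetric]
  puiseux_of_fls_add puiseux_of_fls_uminus puiseux_of_fls_mult

instance
proof
  fix x y z :: "'a puiseux"
  obtain d F G H where d: "d > 0" and xyz: "x = puiseux_of_fls d F" "y = puiseux_of_fls d G"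
    "z = puiseux_of_fls d H"
    using puiseux_of_fls_exists3 .
  note hom = xyz puiseux_of_fls_hom[OF d]
  show "x * y * z = x * (y * z)" unfolding hom by (simp only: mult.assoc)
  show "x * y = y * x" unfolding hom by (simp only: mult.commute)
  show "1 * x = x" unfolding hom by (simp only: mult_1_left)
  show "x + y + z = x + (y + z)" unfolding hom by (simp only: add.assoc)
  show "x + y = y + x" unfolding hom by (simp only: add.commute)
  show "0 + x = x" unfolding hom by (simp only: add_0_left)
  show "- x + x = 0" unfolding hom by (simp only: left_minus)
  show "(x + y) * z = x * z + y * z" unfolding hom by (simp only: distrib_right)
  show "x - y = x + - y" by (simp add: minus_puiseux_def)
  show "(0 :: 'a puiseux) \<noteq> 1" unfolding hom using d by simp
  show "x div y = x * inverse y" by (simp add: divide_puiseux_def)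
  show "inverse (0 :: 'a puiseux) = 0" by (simp add: inverse_puiseux_def)
  show "inverse x * x = 1" if nz: "x \<noteq> 0"
  proof -
    have comm: "a * b = b * a" for a b :: "'a puiseux"
    proof -
      obtain d F G H where "d > 0" "a = puiseux_of_fls d F" "b = puiseux_of_fls d G"
        "a = puiseux_of_fls d H" using puiseux_of_fls_exists3 .
      thus ?thesis by (simp only: puiseux_of_fls_mult mult.commute)
    qed
    have F: "F \<noteq> 0" using nz unfolding hom by blast
    have ex: "x * puiseux_of_fls d (inverse F) = 1"
      unfolding hom using F by (subst right_inverse) simp_all
    have uniq: "w = puiseux_of_fls d (inverse F)" if "x * w = 1" for w
    proof -
      obtain e A B C where e: "e > 0" "x = puiseux_of_fls e A" "w = puiseux_of_fls e B"
        "puiseux_of_fls d (inverse F) = puiseux_of_fls e C"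
        using puiseux_of_fls_exists3 .
      have "A * B = 1" "A * C = 1"
        using that ex unfolding e puiseux_of_fls_hom[OF e(1)] using e(1) by simp_all
      have "B = A * C * B" using \<open>A * C = 1\<close> by simp
      also have "\<dots> = A * B * C" by (simp only: mult_ac)
      finally have "B = C" using \<open>A * B = 1\<close> by simp
      thus ?thesis using e by simp
    qed
    have "x * inverse x = 1"
      using nz theI[of "\<lambda>w. x * w = 1", OF ex uniq] by (simp add: inverse_puiseux_def)
    thus ?thesis by (simp add: comm)
  qed
qed

end

text \<open>
  Valuation and leading coefficient of a nonzero series. The minimum of the support exists because
  the support has a common denominator and is bounded below. The value at \<open>0\<close> is irrelevant (and
  not the conventional \<open>\<infinity>\<close>).
\<close>

definition puiseux_val :: "'a::zero puiseux \<Rightarrow> rat" where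
  "puiseux_val a = (LEAST q. puiseux_coeff a q \<noteq> 0)"

definition puiseux_lc :: "'a::zero puiseux \<Rightarrow> 'a" where
  "puiseux_lc a = puiseux_coeff a (puiseux_val a)"

lemma puiseux_val_works:
  fixes a :: "'a::field puiseux"
  assumes "a \<noteq> 0"
  shows "puiseux_coeff a (puiseux_val a) \<noteq> 0"
    and "puiseux_coeff a q \<noteq> 0 \<Longrightarrow> puiseux_val a \<le> q"
proof -
  obtain d F where d: "d > 0" and a: "a = puiseux_of_fls d F"
    using puiseux_of_fls_exists by blast
  have "F \<noteq> 0" using assms d a by (auto simp: puiseux_of_fls_0)
  let ?m = "of_int (fls_subdegree F) / of_nat d :: rat"
  have m: "puiseux_coeff a ?m \<noteq> 0"
    using a d \<open>F \<noteq> 0\<close> by simp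
  have le: "?m \<le> q" if nz: "puiseux_coeff a q \<noteq> 0" for q
  proof -
    obtain k where k: "q = of_int k / of_nat d"
      using nz puiseux_coeff_of_fls_0[of q d F] unfolding a by blast
    have "F $$ k \<noteq> 0" using nz d unfolding a k by simp
    hence "fls_subdegree F \<le> k" by (rule fls_subdegree_leI)
    thus ?thesis unfolding k by (intro divide_right_mono) simp_all
  qed
  have val: "puiseux_val a = ?m"
    unfolding puiseux_val_def using m le by (rule Least_equality)
  show "puiseux_coeff a (puiseux_val a) \<noteq> 0" unfolding val by (rule m)
  show "puiseux_val a \<le> q" if "puiseux_coeff a q \<noteq> 0" unfolding val using that by (rule le)
qed

unbundle no fps_syntax

section \<open>Multivariate polynomials and initial forms\<close>

text \<open>The variables \<open>x\<^sub>j\<close> are indexed by a finite type \<open>'n\<close>, so \<open>N = CARD('n)\<close>.\<close>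

type_synonym ('n, 'a) mpoly = "('n \<Rightarrow>\<^sub>0 nat) \<Rightarrow>\<^sub>0 'a"

definition Const :: "'a::zero \<Rightarrow> ('n, 'a) mpoly" where
  "Const c = Poly_Mapping.single 0 c"

definition xpow :: "('n \<Rightarrow>\<^sub>0 nat) \<Rightarrow> ('n, 'a::zero_neq_one) mpoly" where
  "xpow \<alpha> = Poly_Mapping.single \<alpha> 1"

definition Var :: "'n \<Rightarrow> ('n, 'a::zero_neq_one) mpoly" where
  "Var j = xpow (Poly_Mapping.single j 1)"

abbreviation coef :: "('n, 'a::zero) mpoly \<Rightarrow> ('n \<Rightarrow>\<^sub>0 nat) \<Rightarrow> 'a" where
  "coef \<equiv> Poly_Mapping.lookup"

abbreviation expo :: "('n \<Rightarrow>\<^sub>0 nat) \<Rightarrow> 'n \<Rightarrow> nat" where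
  "expo \<equiv> Poly_Mapping.lookup"

abbreviation monomials :: "('n, 'a::zero) mpoly \<Rightarrow> ('n \<Rightarrow>\<^sub>0 nat) set" where
  "monomials \<equiv> Poly_Mapping.keys"

definition xpow_eval :: "('n::finite \<Rightarrow>\<^sub>0 nat) \<Rightarrow> 'a::comm_semiring_1 ^ 'n \<Rightarrow> 'a" where
  "xpow_eval \<alpha> x = (\<Prod>j\<in>UNIV. (x $ j) ^ expo \<alpha> j)"

definition poly_eval :: "('n::finite, 'a::comm_semiring_1) mpoly \<Rightarrow> 'a ^ 'n \<Rightarrow> 'a" where
  "poly_eval p x = (\<Sum>\<alpha>\<in>monomials p. coef p \<alpha> * xpow_eval \<alpha> x)"

definition vars :: "('n, 'a::zero) mpoly \<Rightarrow> 'n set" where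
  "vars p = {j. \<exists>\<alpha>\<in>monomials p. expo \<alpha> j \<noteq> 0}"

definition is_binomial :: "('n, 'a::zero) mpoly \<Rightarrow> bool" where
  "is_binomial p \<longleftrightarrow> card (monomials p) = 2"

text \<open>Ideals are the submodules of the ring, regarded as a module over itself.\<close>

global_interpretation ideal: module "(*) :: 'a::comm_ring_1 \<Rightarrow> 'a \<Rightarrow> 'a"
  defines ideal = ideal.span
  by standard (auto simp: algebra_simps)

definition weight :: "real ^ 'n::finite \<Rightarrow> ('n, complex puiseux) mpoly \<Rightarrow> ('n \<Rightarrow>\<^sub>0 nat) \<Rightarrow> real" where
  "weight v f \<alpha> = of_rat (puiseux_val (coef f \<alpha>)) + (\<Sum>j\<in>UNIV. of_nat (expo \<alpha> j) * v $ j)"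

definition initial_form :: "real ^ 'n::finite \<Rightarrow> ('n, complex puiseux) mpoly \<Rightarrow> ('n, complex) mpoly" where
  "initial_form v f = (\<Sum>\<alpha> | \<alpha> \<in> monomials f \<and> (\<forall>\<beta>\<in>monomials f. weight v f \<alpha> \<le> weight v f \<beta>).
                 Poly_Mapping.single \<alpha> (puiseux_lc (coef f \<alpha>)))"

definition initial_ideal ::
    "real ^ 'n::finite \<Rightarrow> ('n, complex puiseux) mpoly set \<Rightarrow> ('n, complex) mpoly set" where
  "initial_ideal v I = ideal {initial_form v f | f. f \<in> I \<and> f \<noteq> 0}"

definition Trop :: "('n::finite, complex puiseux) mpoly set \<Rightarrow> (real ^ 'n) set" where
  "Trop I = {v. \<forall>\<alpha>. xpow \<alpha> \<notin> initial_ideal v I}"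

section \<open>Multilinear network games\<close>

definition equilibrium_poly ::
    "('n::finite \<Rightarrow> 'n set \<Rightarrow> complex puiseux) \<Rightarrow> 'n \<Rightarrow> ('n, complex puiseux) mpoly" where
  "equilibrium_poly c i = (\<Sum>S\<in>Pow (UNIV - {i}). Const (c i S) * (\<Prod>j\<in>S. Var j))"

definition equilibrium_ideal ::
    "('n::finite \<Rightarrow> 'n set \<Rightarrow> complex puiseux) \<Rightarrow> ('n, complex puiseux) mpoly set" where
  "equilibrium_ideal c = ideal (range (equilibrium_poly c))"

definition torus :: "(complex ^ 'n) set" where
  "torus = {x. \<forall>j. x $ j \<noteq> 0}"

text \<open>
  On the torus, the system \<open>g\<^sub>i = 0\<close> is the system of binomial equations
  \<open>x\<^bsup>a i\<^esup> = \<lambda>\<^sub>i x\<^bsup>b i\<^esup>\<close>, obtained by moving one of the two terms of \<open>g\<^sub>i\<close> to the other side.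
\<close>

definition binomial_system :: "('n::finite \<Rightarrow> ('n, complex) mpoly) \<Rightarrow>
    ('n \<Rightarrow> ('n \<Rightarrow>\<^sub>0 nat)) \<Rightarrow> ('n \<Rightarrow> ('n \<Rightarrow>\<^sub>0 nat)) \<Rightarrow> ('n \<Rightarrow> complex) \<Rightarrow> bool" where
  "binomial_system g a b lam \<longleftrightarrow>
     (\<forall>i. lam i \<noteq> 0 \<and> monomials (g i) = {a i, b i} \<and>
          (\<forall>x\<in>torus. poly_eval (g i) x = 0 \<longleftrightarrow> xpow_eval (a i) x = lam i * xpow_eval (b i) x))"

definition exponent_matrix ::
    "('n::finite \<Rightarrow> ('n \<Rightarrow>\<^sub>0 nat)) \<Rightarrow> ('n \<Rightarrow> ('n \<Rightarrow>\<^sub>0 nat)) \<Rightarrow> int ^ 'n ^ 'n" where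
  "exponent_matrix a b = (\<chi> i j. int (expo (a i) j) - int (expo (b i) j))"

section \<open>Dependency graph and block triangular form\<close>

definition dependency_graph :: "('n \<Rightarrow> ('n, complex) mpoly) \<Rightarrow> ('n, 'n \<times> 'n) pre_digraph" where
  "dependency_graph g = with_proj \<lparr>pverts = UNIV, parcs = {(i, j). j \<in> vars (g i)}\<rparr>"

definition comp_reachable :: "('n, 'e) pre_digraph \<Rightarrow> 'n set \<Rightarrow> 'n set \<Rightarrow> bool" where
  "comp_reachable G C D \<longleftrightarrow> (\<exists>u\<in>C. \<exists>w\<in>D. u \<rightarrow>\<^sup>*\<^bsub>G\<^esub> w)"

text \<open>
  Given a list \<open>ns\<close> of block sizes, \<open>block ns k\<close> is the set of positions in the \<open>k\<close>-th block
  when \<open>{0..<sum_list ns}\<close> is cut into consecutive intervals of these sizes.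
\<close>

definition block :: "nat list \<Rightarrow> nat \<Rightarrow> nat set" where
  "block ns k = {sum_list (take k ns) ..< sum_list (take (Suc k) ns)}"

definition block_upper_triangular :: "nat list \<Rightarrow> (nat \<Rightarrow> nat \<Rightarrow> 'a::zero) \<Rightarrow> bool" where
  "block_upper_triangular ns M \<longleftrightarrow>
     (\<forall>k<length ns. \<forall>l<k. \<forall>p\<in>block ns k. \<forall>q\<in>block ns l. M p q = 0)"

definition permute_matrix :: "(nat \<Rightarrow> 'n) \<Rightarrow> 'a ^ 'n ^ 'n \<Rightarrow> nat \<Rightarrow> nat \<Rightarrow> 'a" where
  "permute_matrix \<sigma> A p q = A $ \<sigma> p $ \<sigma> q"

text \<open>
  The enumeration \<open>\<sigma>\<close> of the indices lists the strongly connected components one after the other,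
  in the order \<open>Cs\<close>, which is a linear extension of the reachability order on components.
\<close>

definition scc_ordering :: "('n::finite, 'e) pre_digraph \<Rightarrow> 'n set list \<Rightarrow> (nat \<Rightarrow> 'n) \<Rightarrow> bool" where
  "scc_ordering G Cs \<sigma> \<longleftrightarrow>
     distinct Cs \<and> set Cs = pre_digraph.sccs_verts G \<and>
     bij_betw \<sigma> {..<CARD('n)} UNIV \<and>
     (\<forall>k<length Cs. \<sigma> ` block (map card Cs) k = Cs ! k) \<and>
     (\<forall>k<length Cs. \<forall>l<length Cs. comp_reachable G (Cs ! k) (Cs ! l) \<longrightarrow> k \<le> l)"

end

theory Submission
  imports Defs
begin

text \<open>
  A binomial \<open>\<alpha> x\<^bsup>a\<^esup> + \<beta> x\<^bsup>b\<^esup>\<close> equals the unit \<open>\<alpha>\<close> times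
  \<open>x\<^bsup>a\<^esup> - \<lambda> x\<^bsup>b\<^esup>\<close> with \<open>\<lambda> = - \<beta> / \<alpha>\<close>. Exchanging generators for unit multiples changes neither
  the ideal nor its zeros, which gives the normal form of the system
  (\<open>binomial_normal_form\<close>); that the zeros of an ideal are the common zeros of its generators
  rests on evaluation being a ring homomorphism (\<open>poly_eval_mult\<close>).

  For the triangular form, let the components be listed by decreasing number of vertices that can
  be reached from them. If \<open>C\<close> reaches \<open>D \<noteq> C\<close>, then \<open>D\<close> does not reach \<open>C\<close>, so \<open>D\<close> reaches strictly
  fewer vertices and comes later (\<open>sccs_linear_extension\<close>). Concatenating enumerations of
  the components turns this list into an enumeration of the indices whose blocks
  are the components (\<open>enumeration_by_blocks\<close>). A nonzero entry \<open>(i, j)\<close> of the exponent matrix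
  requires \<open>x\<^sub>j\<close> to occur in the \<open>i\<close>-th binomial, so it is an edge \<open>i \<rightarrow> j\<close>, and the component of
  \<open>i\<close> reaches that of \<open>j\<close>: such an entry cannot lie below the diagonal blocks.
\<close>

section \<open>Zeros of an ideal\<close>

lemma xpow_eval_add: "xpow_eval (\<alpha> + \<beta>) x = xpow_eval \<alpha> x * xpow_eval \<beta> x"
  by (simp add: xpow_eval_def lookup_add power_add prod.distrib)

text \<open>
  Terms may cancel in a sum of polynomials, so sums are compared over a common superset of
  the monomials that occur.
\<close>

lemma poly_eval_superset:
  assumes "finite A" "monomials p \<subseteq> A"
  shows "poly_eval p x = (\<Sum>\<alpha>\<in>A. coef p \<alpha> * xpow_eval \<alpha> x)"
  unfolding poly_eval_def
  by (rule sum.mono_neutral_left) (use assms in \<open>auto simp: in_keys_iff\<close>)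

lemma poly_eval_0 [simp]: "poly_eval 0 x = 0"
  by (simp add: poly_eval_def)

lemma poly_eval_single [simp]: "poly_eval (Poly_Mapping.single \<alpha> c) x = c * xpow_eval \<alpha> x"
  by (subst poly_eval_superset[where A = "{\<alpha>}"]) auto

lemma poly_eval_Const [simp]: "poly_eval (Const c) x = c"
  by (simp add: Const_def xpow_eval_def)

lemma poly_eval_xpow [simp]: "poly_eval (xpow \<alpha>) x = xpow_eval \<alpha> x"
  by (simp add: xpow_def)

lemma poly_eval_add: "poly_eval (p + q) x = poly_eval p x + poly_eval q x"
proof -
  let ?A = "monomials p \<union> monomials q"
  have "poly_eval (p + q) x = (\<Sum>\<alpha>\<in>?A. coef (p + q) \<alpha> * xpow_eval \<alpha> x)"
    by (rule poly_eval_superset) (use Poly_Mapping.keys_add[of p q] in auto)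
  also have "\<dots> = (\<Sum>\<alpha>\<in>?A. coef p \<alpha> * xpow_eval \<alpha> x) + (\<Sum>\<alpha>\<in>?A. coef q \<alpha> * xpow_eval \<alpha> x)"
    by (simp add: lookup_add distrib_right sum.distrib)
  also have "\<dots> = poly_eval p x + poly_eval q x"
    by (simp add: poly_eval_superset[where A = ?A])
  finally show ?thesis .
qed

lemma poly_eval_diff:
  fixes p q :: "('n::finite, 'a::comm_ring_1) mpoly"
  shows "poly_eval (p - q) x = poly_eval p x - poly_eval q x"
  using poly_eval_add[of "p - q" q x] by simp

lemma poly_eval_sum: "poly_eval (\<Sum>i\<in>A. f i) x = (\<Sum>i\<in>A. poly_eval (f i) x)"
  by (induction A rule: infinite_finite_induct) (simp_all add: poly_eval_add)

lemma mpoly_eq_sum_terms: "p = (\<Sum>\<alpha>\<in>monomials p. Poly_Mapping.single \<alpha> (coef p \<alpha>))"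
  by (rule poly_mapping_eqI)
     (simp add: lookup_sum lookup_single when_def in_keys_iff)

lemma poly_eval_mult: "poly_eval (p * q) x = poly_eval p x * poly_eval q x"
proof -
  have "p * q = (\<Sum>\<alpha>\<in>monomials p. \<Sum>\<beta>\<in>monomials q.
      Poly_Mapping.single (\<alpha> + \<beta>) (coef p \<alpha> * coef q \<beta>))"
    unfolding mult_single[symmetric] sum_product[symmetric] mpoly_eq_sum_terms[symmetric] ..
  hence "poly_eval (p * q) x = (\<Sum>\<alpha>\<in>monomials p. \<Sum>\<beta>\<in>monomials q.
      coef p \<alpha> * coef q \<beta> * xpow_eval (\<alpha> + \<beta>) x)"
    by (simp add: poly_eval_sum)
  also have "\<dots> = poly_eval p x * poly_eval q x"
    unfolding poly_eval_def by (simp add: xpow_eval_add sum_product mult_ac)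
  finally show ?thesis .
qed

lemma ideal_zeros_iff:
  fixes x :: "'a::comm_ring_1 ^ 'n::finite"
  shows "(\<forall>h\<in>ideal S. poly_eval h x = 0) \<longleftrightarrow> (\<forall>h\<in>S. poly_eval h x = 0)"
proof
  assume S: "\<forall>h\<in>S. poly_eval h x = 0"
  have "ideal.subspace {h. poly_eval h x = 0}"
    by (rule ideal.subspaceI) (simp_all add: poly_eval_add poly_eval_mult)
  moreover have "S \<subseteq> {h. poly_eval h x = 0}" using S by blast
  ultimately show "\<forall>h\<in>ideal S. poly_eval h x = 0" using ideal.span_minimal by blast
qed (use ideal.span_superset in blast)

section \<open>Binomial generators\<close>

text \<open>
  The factor \<open>u\<close> is the coefficient of \<open>x\<^bsup>a\<^esup>\<close>. As a nonzero constant it is a unit of the polynomial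
  ring, so it can be dropped from a generator of an ideal.
\<close>

lemma binomial_normal_form:
  fixes p :: "('n, 'a::field) mpoly"
  assumes "is_binomial p"
  obtains a b lam u where "monomials p = {a, b}" "lam \<noteq> 0" "u \<noteq> 0"
    "p = Const u * (xpow a - Const lam * xpow b)"
proof -
  obtain a b where ab: "monomials p = {a, b}" "a \<noteq> b"
    using assms unfolding is_binomial_def card_2_iff by blast
  have nz: "coef p a \<noteq> 0" "coef p b \<noteq> 0"
    using ab(1) by (auto simp flip: in_keys_iff)
  have "p = Poly_Mapping.single a (coef p a) + Poly_Mapping.single b (coef p b)"
    by (subst mpoly_eq_sum_terms[of p]) (use ab in simp)
  also have "\<dots> = Const (coef p a) * (xpow a - Const (- coef p b / coef p a) * xpow b)"
    using nz by (simp add: Const_def xpow_def mult_single distrib_left right_diff_distrib single_uminus)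
  finally show thesis
    using ab(1) nz by (intro that[of a b "- coef p b / coef p a" "coef p a"]) simp_all
qed

lemma ideal_range_mutual_multiples:
  fixes f g :: "'i \<Rightarrow> 'a::comm_ring_1"
  assumes "\<And>i. f i = u i * g i" "\<And>i. g i = w i * f i"
  shows "ideal (range f) = ideal (range g)"
proof -
  have "f i \<in> ideal (range g)" for i
    unfolding assms(1)[of i] by (intro ideal.span_scale ideal.span_base) blast
  moreover have "g i \<in> ideal (range f)" for i
    unfolding assms(2)[of i] by (intro ideal.span_scale ideal.span_base) blast
  ultimately show ?thesis unfolding ideal.span_eq by blast
qed

lemma binomial_generators:
  fixes g :: "'n::finite \<Rightarrow> ('n, complex) mpoly"
  assumes "\<And>i. is_binomial (g i)"
  obtains a b lam where "binomial_system g a b lam"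
    "ideal (range g) = ideal (range (\<lambda>i. xpow (a i) - Const (lam i) * xpow (b i)))"
proof -
  have "\<exists>a b lam u. monomials (g i) = {a, b} \<and> lam \<noteq> 0 \<and> u \<noteq> 0 \<and>
      g i = Const u * (xpow a - Const lam * xpow b)" for i
    by (rule binomial_normal_form[OF assms[of i]]) blast
  then obtain a b lam u where mon: "\<And>i. monomials (g i) = {a i, b i}"
    and nz: "\<And>i. lam i \<noteq> 0" "\<And>i. u i \<noteq> 0"
    and g: "\<And>i. g i = Const (u i) * (xpow (a i) - Const (lam i) * xpow (b i))"
    by metis
  have ev: "poly_eval (g i) x = u i * (xpow_eval (a i) x - lam i * xpow_eval (b i) x)" for i x
    unfolding g by (simp add: poly_eval_mult poly_eval_diff)
  have "binomial_system g a b lam"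
    unfolding binomial_system_def using mon nz ev by simp
  moreover have "ideal (range g) = ideal (range (\<lambda>i. xpow (a i) - Const (lam i) * xpow (b i)))"
  proof (rule ideal_range_mutual_multiples[OF g])
    fix i
    have "Const (1 / u i) * Const (u i) = (1 :: ('n, complex) mpoly)"
      using nz by (simp add: Const_def mult_single)
    thus "xpow (a i) - Const (lam i) * xpow (b i) = Const (1 / u i) * g i"
      unfolding g by (simp flip: mult.assoc)
  qed
  ultimately show thesis by (rule that)
qed

section \<open>Ordering the strongly connected components\<close>

text \<open>
  Any two vertices of a component reach each other, so the choice of representatives is
  immaterial.
\<close>

lemma (in wf_digraph) comp_reachable_vertices:
  assumes "C \<in> sccs_verts" "D \<in> sccs_verts" "comp_reachable G C D" "u \<in> C" "w \<in> D"
  shows "u \<rightarrow>\<^sup>* w"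
proof -
  obtain u' w' where "u' \<in> C" "w' \<in> D" "u' \<rightarrow>\<^sup>* w'"
    using assms(3) unfolding comp_reachable_def by blast
  moreover have "u \<rightarrow>\<^sup>* u'" "w' \<rightarrow>\<^sup>* w"
    using assms calculation unfolding in_sccs_verts_conv_reachable by blast+
  ultimately show ?thesis by (meson reachable_trans)
qed

text \<open>
  The number of reachable vertices measures the height of a component: if \<open>C\<close> reaches
  another component \<open>D\<close>, everything reachable from \<open>D\<close> is reachable from \<open>C\<close>, but the vertices of
  \<open>C\<close> itself are not reachable from \<open>D\<close>.
\<close>

lemma (in fin_digraph) reachable_count_strict_decreasing:
  assumes C: "C \<in> sccs_verts" and D: "D \<in> sccs_verts"
    and "comp_reachable G C D" "C \<noteq> D"
  shows "card {w. \<exists>u\<in>D. u \<rightarrow>\<^sup>* w} < card {w. \<exists>u\<in>C. u \<rightarrow>\<^sup>* w}"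
proof (rule psubset_card_mono)
  have "{w. \<exists>u\<in>C. u \<rightarrow>\<^sup>* w} \<subseteq> verts G" by (auto dest: reachable_in_verts)
  thus "finite {w. \<exists>u\<in>C. u \<rightarrow>\<^sup>* w}" by (rule finite_subset) simp
  obtain u where u: "u \<in> C" using C unfolding in_sccs_verts_conv_reachable by blast
  have reach: "u \<rightarrow>\<^sup>* w" if "w \<in> D" for w
    using comp_reachable_vertices[OF C D assms(3) u that] .
  have "u \<notin> D" using sccs_verts_disjoint[OF C D assms(4)] u by blast
  hence not_back: "\<not> w \<rightarrow>\<^sup>* u" if "w \<in> D" for w
    using D reach[OF that] that unfolding in_sccs_verts_conv_reachable by blast
  have "u \<rightarrow>\<^sup>* u" using sccs_verts_subsets[OF C] u by blast
  show "{w. \<exists>u\<in>D. u \<rightarrow>\<^sup>* w} \<subset> {w. \<exists>u\<in>C. u \<rightarrow>\<^sup>* w}"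
  proof (rule psubsetI)
    show "{w. \<exists>u\<in>D. u \<rightarrow>\<^sup>* w} \<subseteq> {w. \<exists>u\<in>C. u \<rightarrow>\<^sup>* w}"
      using u reach by (blast intro: reachable_trans)
    show "{w. \<exists>u\<in>D. u \<rightarrow>\<^sup>* w} \<noteq> {w. \<exists>u\<in>C. u \<rightarrow>\<^sup>* w}"
      using u \<open>u \<rightarrow>\<^sup>* u\<close> not_back by blast
  qed
qed

text \<open>
  Sorting by a strictly monotone measure is a topological sort of the condensation; components
  with equally many reachable vertices are incomparable, so ties may be broken arbitrarily.
\<close>

lemma (in fin_digraph) sccs_linear_extension:
  obtains Cs where "distinct Cs" "set Cs = sccs_verts"
    "\<And>k l. k < length Cs \<Longrightarrow> l < length Cs \<Longrightarrow> comp_reachable G (Cs ! k) (Cs ! l) \<Longrightarrow> k \<le> l"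
proof -
  obtain xs where xs: "set xs = sccs_verts" "distinct xs"
    using finite_distinct_list[OF finite_sccs_verts] by blast
  \<comment> \<open>The negated count, because sorting by a key is increasing.\<close>
  let ?h = "\<lambda>C. - int (card {w. \<exists>u\<in>C. u \<rightarrow>\<^sup>* w})"
  let ?Cs = "sort_key ?h xs"
  have set: "set ?Cs = sccs_verts" and dist: "distinct ?Cs" using xs by simp_all
  have "k \<le> l" if k: "k < length ?Cs" and l: "l < length ?Cs"
    and r: "comp_reachable G (?Cs ! k) (?Cs ! l)" for k l
  proof (rule ccontr)
    assume "\<not> k \<le> l"
    hence lk: "l < k" by simp
    have "sorted (map ?h ?Cs)" by (rule sorted_sort_key)
    hence "map ?h ?Cs ! l \<le> map ?h ?Cs ! k"
      by (rule sorted_nth_mono) (use lk k in simp_all)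
    hence "?h (?Cs ! l) \<le> ?h (?Cs ! k)" using k l by (simp only: nth_map)
    moreover have "?Cs ! k \<noteq> ?Cs ! l"
      using dist k l lk by (simp only: nth_eq_iff_index_eq)
    moreover have "?Cs ! k \<in> sccs_verts" "?Cs ! l \<in> sccs_verts"
      using nth_mem[OF k] nth_mem[OF l] set by simp_all
    ultimately show False using reachable_count_strict_decreasing[OF _ _ r] by fastforce
  qed
  with set dist show thesis by (intro that[of ?Cs])
qed

text \<open>
  The enumeration indexes the concatenation of enumerations of the single sets; the \<open>k\<close>-th block
  of positions is the range that the \<open>k\<close>-th list occupies in it.
\<close>

lemma enumeration_by_blocks:
  fixes Cs :: "'n::finite set list"
  assumes "distinct Cs" "\<Union> (set Cs) = UNIV" "disjoint (set Cs)"
  obtains \<sigma> where "bij_betw \<sigma> {..<CARD('n)} UNIV"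
    "\<And>k. k < length Cs \<Longrightarrow> \<sigma> ` block (map card Cs) k = Cs ! k"
proof -
  define L where "L C = (SOME xs. set xs = C \<and> distinct xs)" for C :: "'n set"
  have L: "set (L C) = C" "distinct (L C)" for C
    using someI_ex[OF finite_distinct_list[of C]] unfolding L_def by simp_all
  have len: "length (L C) = card C" for C
    using distinct_card[OF L(2)[of C]] L(1)[of C] by simp
  let ?xs = "concat (map L Cs)"
  have set: "set ?xs = UNIV" using assms(2) L(1) by simp
  have dist: "distinct ?xs"
  proof (rule distinct_concat)
    have "inj_on L (set Cs)" by (rule inj_onI) (metis L(1))
    thus "distinct (map L Cs)" using assms(1) by (simp add: distinct_map)
    show "set ys \<inter> set zs = {}"
      if yz: "ys \<in> set (map L Cs)" "zs \<in> set (map L Cs)" "ys \<noteq> zs" for ys zs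
    proof -
      obtain C D where "C \<in> set Cs" "D \<in> set Cs" "ys = L C" "zs = L D"
        using yz(1,2) unfolding set_map by blast
      moreover from this yz(3) have "C \<noteq> D" by blast
      ultimately show ?thesis using assms(3) L(1) by (simp add: pairwise_def disjnt_def)
    qed
  qed (use L(2) in auto)
  have "CARD('n) = length ?xs" using distinct_card[OF dist] unfolding set .
  hence "bij_betw (\<lambda>p. ?xs ! p) {..<CARD('n)} UNIV"
    by (intro bij_betw_nth[OF dist]) (simp_all only: set)
  moreover have "(\<lambda>p. ?xs ! p) ` block (map card Cs) k = Cs ! k" if k: "k < length Cs" for k
  proof -
    let ?A = "concat (map L (take k Cs))" and ?B = "L (Cs ! k)"
    let ?R = "concat (map L (drop (Suc k) Cs))"
    have "?xs = ?A @ ?B @ ?R"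
      by (subst id_take_nth_drop[OF k]) simp
    moreover have "block (map card Cs) k = {length ?A..<length ?A + length ?B}"
      using k len by (simp add: block_def take_Suc_conv_app_nth length_concat take_map comp_def)
    moreover have "(\<lambda>p. (?A @ ?B @ ?R) ! p) ` {length ?A..<length ?A + length ?B} = set ?B"
    proof -
      have "{length ?A..<length ?A + length ?B} = (\<lambda>p. p + length ?A) ` {0..<length ?B}"
        by (simp add: add.commute)
      hence "(\<lambda>p. (?A @ ?B @ ?R) ! p) ` {length ?A..<length ?A + length ?B} =
          (\<lambda>p. (?A @ ?B @ ?R) ! (p + length ?A)) ` {0..<length ?B}"
        by (simp only: image_image)
      also have "\<dots> = (!) ?B ` {0..<length ?B}"
        by (rule image_cong) (simp_all add: nth_append)
      also have "\<dots> = set ?B" by (metis set_upt list.set_map map_nth)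
      finally show ?thesis .
    qed
    ultimately show ?thesis using L(1) by simp
  qed
  ultimately show thesis by (rule that)
qed

lemma scc_ordering_exists:
  fixes G :: "('n::finite, 'e) pre_digraph"
  assumes "fin_digraph G" "verts G = UNIV"
  obtains Cs \<sigma> where "scc_ordering G Cs \<sigma>"
proof -
  interpret fin_digraph G by fact
  obtain Cs where Cs: "distinct Cs" "set Cs = sccs_verts"
    "\<And>k l. k < length Cs \<Longrightarrow> l < length Cs \<Longrightarrow> comp_reachable G (Cs ! k) (Cs ! l) \<Longrightarrow> k \<le> l"
    using sccs_linear_extension by blast
  have "u \<in> \<Union> (set Cs)" for u
    using scc_of_in_sccs_verts[of u] in_scc_of_self[of u] assms(2) Cs(2) by auto
  hence "\<Union> (set Cs) = UNIV" by blast
  moreover have "disjoint (set Cs)"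
    unfolding Cs(2) by (intro disjointI sccs_verts_disjoint)
  ultimately obtain \<sigma> where "bij_betw \<sigma> {..<CARD('n)} UNIV"
    "\<And>k. k < length Cs \<Longrightarrow> \<sigma> ` block (map card Cs) k = Cs ! k"
    using enumeration_by_blocks[OF Cs(1)] by blast
  with Cs have "scc_ordering G Cs \<sigma>" unfolding scc_ordering_def by blast
  thus thesis by (rule that)
qed

section \<open>The dependency graph\<close>

lemma fin_digraph_dependency_graph:
  fixes g :: "'n::finite \<Rightarrow> ('n, complex) mpoly"
  shows "fin_digraph (dependency_graph g)"
  by unfold_locales (simp_all add: dependency_graph_def)

lemma verts_dependency_graph [simp]: "verts (dependency_graph g) = UNIV"
  by (simp add: dependency_graph_def)

lemma binomial_system_dependency:
  assumes "binomial_system g a b lam" "expo (a i) j \<noteq> 0 \<or> expo (b i) j \<noteq> 0"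
  shows "i \<rightarrow>\<^sup>*\<^bsub>dependency_graph g\<^esub> j"
proof -
  interpret fin_digraph "dependency_graph g" by (rule fin_digraph_dependency_graph)
  have "j \<in> vars (g i)"
    using assms by (auto simp: vars_def binomial_system_def)
  hence "i \<rightarrow>\<^bsub>dependency_graph g\<^esub> j"
    by (simp add: dependency_graph_def)
  thus ?thesis by (rule reachable_adjI)
qed

text \<open>
  A nonzero entry in block row \<open>k\<close> and block column \<open>l\<close> makes the \<open>k\<close>-th component reach the
  \<open>l\<close>-th, and the ordering then forces \<open>k \<le> l\<close>.
\<close>

lemma scc_ordering_block_upper_triangular:
  assumes ord: "scc_ordering (dependency_graph g) Cs \<sigma>" and sys: "binomial_system g a b lam"
  shows "block_upper_triangular (map card Cs) (permute_matrix \<sigma> (exponent_matrix a b))"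
  unfolding block_upper_triangular_def
proof (intro allI impI ballI, rule ccontr)
  fix k l p q
  assume k: "k < length (map card Cs)" and lk: "l < k"
    and p: "p \<in> block (map card Cs) k" and q: "q \<in> block (map card Cs) l"
    and nz: "permute_matrix \<sigma> (exponent_matrix a b) p q \<noteq> 0"
  have kl: "k < length Cs" "l < length Cs" using k lk by simp_all
  have "expo (a (\<sigma> p)) (\<sigma> q) \<noteq> 0 \<or> expo (b (\<sigma> p)) (\<sigma> q) \<noteq> 0"
    using nz by (auto simp: permute_matrix_def exponent_matrix_def)
  hence "\<sigma> p \<rightarrow>\<^sup>*\<^bsub>dependency_graph g\<^esub> \<sigma> q" by (rule binomial_system_dependency[OF sys])
  moreover have "\<sigma> p \<in> Cs ! k" "\<sigma> q \<in> Cs ! l"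
    using ord kl p q unfolding scc_ordering_def by blast+
  ultimately have "comp_reachable (dependency_graph g) (Cs ! k) (Cs ! l)"
    unfolding comp_reachable_def by blast
  with ord kl have "k \<le> l" unfolding scc_ordering_def by blast
  with lk show False by simp
qed

lemma binomial_system_component_dependency:
  assumes "binomial_system g a b lam" "i \<in> C" "expo (a i) j \<noteq> 0 \<or> expo (b i) j \<noteq> 0"
  shows "\<exists>D\<in>pre_digraph.sccs_verts (dependency_graph g). j \<in> D \<and>
           comp_reachable (dependency_graph g) C D"
proof -
  interpret fin_digraph "dependency_graph g" by (rule fin_digraph_dependency_graph)
  have "scc_of j \<in> sccs_verts" "j \<in> scc_of j"
    by (simp_all add: scc_of_in_sccs_verts in_scc_of_self)
  thus ?thesis
    using assms(2) binomial_system_dependency[OF assms(1,3)] unfolding comp_reachable_def by blast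
qed

section \<open>The block structure of the initial system\<close>

theorem theorem4p3:
  fixes c :: "'n::finite \<Rightarrow> 'n set \<Rightarrow> complex puiseux"
    and v :: "real ^ 'n"
  defines "g \<equiv> \<lambda>i. initial_form v (equilibrium_poly c i)"
  defines "J \<equiv> ideal (range g)"
  defines "G \<equiv> dependency_graph g"
  assumes trop: "v \<in> Trop (equilibrium_ideal c)"
    and binom: "\<And>i. is_binomial (g i)"
  shows "(\<exists>a b lam. binomial_system g a b lam \<and>
            J = ideal (range (\<lambda>i. xpow (a i) - Const (lam i) * xpow (b i))) \<and>
            {x \<in> torus. \<forall>h\<in>J. poly_eval h x = 0} =
            {x \<in> torus. \<forall>i. xpow_eval (a i) x = lam i * xpow_eval (b i) x}) \<and>
         (\<exists>Cs \<sigma>. scc_ordering G Cs \<sigma> \<and>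
            (\<forall>a b lam. binomial_system g a b lam \<longrightarrow>
               block_upper_triangular (map card Cs) (permute_matrix \<sigma> (exponent_matrix a b)))) \<and>
         (\<forall>a b lam. binomial_system g a b lam \<longrightarrow>
            (\<forall>C\<in>pre_digraph.sccs_verts G. \<forall>i\<in>C. \<forall>j. expo (a i) j \<noteq> 0 \<or> expo (b i) j \<noteq> 0 \<longrightarrow>
               (\<exists>D\<in>pre_digraph.sccs_verts G. j \<in> D \<and> comp_reachable G C D)))"
proof (intro conjI)
  obtain a b lam where sys: "binomial_system g a b lam"
    and J: "J = ideal (range (\<lambda>i. xpow (a i) - Const (lam i) * xpow (b i)))"
    using binomial_generators[of g] binom unfolding J_def by blast
  have "{x \<in> torus. \<forall>h\<in>J. poly_eval h x = 0} =
      {x \<in> torus. \<forall>i. xpow_eval (a i) x = lam i * xpow_eval (b i) x}"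
    using sys unfolding J_def ideal_zeros_iff binomial_system_def by auto
  with sys J show "\<exists>a b lam. binomial_system g a b lam \<and>
      J = ideal (range (\<lambda>i. xpow (a i) - Const (lam i) * xpow (b i))) \<and>
      {x \<in> torus. \<forall>h\<in>J. poly_eval h x = 0} =
      {x \<in> torus. \<forall>i. xpow_eval (a i) x = lam i * xpow_eval (b i) x}" by blast
next
  obtain Cs \<sigma> where "scc_ordering G Cs \<sigma>"
    unfolding G_def
    by (rule scc_ordering_exists[OF fin_digraph_dependency_graph verts_dependency_graph])
  thus "\<exists>Cs \<sigma>. scc_ordering G Cs \<sigma> \<and> (\<forall>a b lam. binomial_system g a b lam \<longrightarrow>
      block_upper_triangular (map card Cs) (permute_matrix \<sigma> (exponent_matrix a b)))"
    unfolding G_def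
    by (intro exI conjI allI impI) (assumption, rule scc_ordering_block_upper_triangular)
next
  show "\<forall>a b lam. binomial_system g a b lam \<longrightarrow>
      (\<forall>C\<in>pre_digraph.sccs_verts G. \<forall>i\<in>C. \<forall>j. expo (a i) j \<noteq> 0 \<or> expo (b i) j \<noteq> 0 \<longrightarrow>
         (\<exists>D\<in>pre_digraph.sccs_verts G. j \<in> D \<and> comp_reachable G C D))"
    unfolding G_def by (intro allI impI ballI) (rule binomial_system_component_dependency)
qed

end
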